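(* For $0<t<\pi/3$ let $\mathcal{E}_t$ be the axis-aligned ellipse with center $(0,-\sin t)$, horizontal semi-axis $a(t)=\frac{\sqrt{2\cos t-1}}{2}$ and vertical semi-axis $b(t)=\frac{\sqrt{(2\cos t-1)(1-\cos t)}}{\sqrt2}$. The envelope $\xi$ of the family $\{\mathcal{E}_t\}$ is given by the points $$\xi_{1,t},\xi_{2,t}=\left(\pm\frac{\sqrt{5\cos t-3}}{2\sqrt{\cos t+1}},\;-\frac{2\sin t}{\cos t+1}\right)\qquad(\cos t\ge 3/5),$$ and it is contained in the ellipse $4x^2+y^2-1=0$. Furthermore, the points $X_{15}=(0,-\sqrt3/2)$ and $X_{16}=(0,\sqrt3/2)$ are the foci of this ellipse.
   Context: The envelope of the family is the set of real points $(x,y)$ satisfying, for some $t$, both $F(x,y,t)=0$ and $\partial_tF(x,y,t)=0$, where $F(x,y,t)=\frac{x^2}{a(t)^2}+\frac{(y+\sin t)^2}{b(t)^2}-1$. The ellipses $\mathcal{E}_t$ are the Brocard inellipses of a family of Brocard porisms (families of triangles inscribed in a circle and circumscribed about their common Brocard inellipse, the inscribed ellipse whose foci are the Brocard points) which all share the isodynamic points $X_{15},X_{16}$ given in the claim. *)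

theory Defs
  imports "HOL-Analysis.Analysis"
begin

definition semi_a :: "real \<Rightarrow> real" where
  "semi_a t = sqrt (2 * cos t - 1) / 2"

definition semi_b :: "real \<Rightarrow> real" where
  "semi_b t = sqrt ((2 * cos t - 1) * (1 - cos t)) / sqrt 2"

text \<open>
  For \<open>0 < t < pi / 3\<close> both semi-axes are positive, and the zero set of
  \<open>\<lambda>x y. ellipse_fun x y t\<close> is the member of the family with parameter \<open>t\<close>.
\<close>

definition ellipse_fun :: "real \<Rightarrow> real \<Rightarrow> real \<Rightarrow> real" where
  "ellipse_fun x y t = x\<^sup>2 / (semi_a t)\<^sup>2 + (y + sin t)\<^sup>2 / (semi_b t)\<^sup>2 - 1"

text \<open>
  The derivative condition is stated relationally, so it also asserts that the partial
  derivative in the parameter exists.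
\<close>

definition envelope :: "real set \<Rightarrow> (real \<Rightarrow> real \<Rightarrow> real \<Rightarrow> real) \<Rightarrow> (real \<times> real) set" where
  "envelope T F =
     {(x, y). \<exists>t\<in>T. F x y t = 0 \<and> ((\<lambda>s. F x y s) has_real_derivative 0) (at t)}"

definition xi1 :: "real \<Rightarrow> real \<times> real" where
  "xi1 t = (sqrt (5 * cos t - 3) / (2 * sqrt (cos t + 1)), - (2 * sin t / (cos t + 1)))"

definition xi2 :: "real \<Rightarrow> real \<times> real" where
  "xi2 t = (- (sqrt (5 * cos t - 3) / (2 * sqrt (cos t + 1))), - (2 * sin t / (cos t + 1)))"

text \<open>
  All foci of a plane curve in the sense of the two-focus description of a nondegenerate
  ellipse (a circle being the case \<open>p = q\<close>); the set is empty if the curve is not an ellipse.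
  The distance on \<open>real \<times> real\<close> is the Euclidean one.
\<close>

definition foci :: "(real \<times> real) set \<Rightarrow> (real \<times> real) set" where
  "foci S = {p. \<exists>q r. dist p q < r \<and> S = {z. dist z p + dist z q = r}}"

definition X15 :: "real \<times> real" where
  "X15 = (0, - (sqrt 3 / 2))"

definition X16 :: "real \<times> real" where
  "X16 = (0, sqrt 3 / 2)"

end

theory Submission
  imports Defs
begin

text \<open>
  On the parameter interval \<open>F = N / (2 cos t - 1) - 1\<close> with
  \<open>N = 4 x\<^sup>2 + 2 (y + sin t)\<^sup>2 / (1 - cos t)\<close>, so the envelope conditions become
  \<open>N = 2 cos t - 1\<close> and \<open>N' = - 2 sin t\<close>. The second one is quadratic in \<open>y + sin t\<close> with
  roots \<open>sin t\<close> and \<open>- (1 - cos t)\<^sup>2 / sin t\<close>; the first root would force \<open>4 x\<^sup>2 = -3\<close>, and the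
  second one gives the claimed points.

  For the foci, squaring \<open>dist z p + dist z q = r\<close> twice yields a quadratic equation in \<open>z\<close>.
  Evaluating it at five points of the ellipse determines its coefficients up to scaling, and
  these determine \<open>p\<close>.
\<close>

section \<open>Parameter range, closed form of the family and its derivative\<close>

lemma cos_gt_half:
  assumes "t \<in> {0<..<pi / 3}"
  shows "1 / 2 < cos t"
  using cos_monotone_0_pi[of t "pi / 3"] assms pi_gt_zero by (simp add: cos_60)

lemma cos_less_one:
  assumes "t \<in> {0<..<pi / 3}"
  shows "cos t < 1"
  using cos_monotone_0_pi[of 0 t] assms by simp

lemma sin_pos:
  assumes "t \<in> {0<..<pi / 3}"
  shows "0 < sin t"
  using assms by (intro sin_gt_zero) auto

text \<open>Both radicands are positive on the interval, so squaring removes the roots and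
  \<open>2 * cos t - 1\<close> becomes a common denominator.\<close>

lemma ellipse_fun_eq:
  assumes "t \<in> {0<..<pi / 3}"
  shows "ellipse_fun x y t =
    (4 * x\<^sup>2 + 2 * (y + sin t)\<^sup>2 / (1 - cos t)) / (2 * cos t - 1) - 1"
proof -
  have c: "2 * cos t - 1 > 0" "1 - cos t > 0"
    using cos_gt_half[OF assms] cos_less_one[OF assms] by auto
  have a: "(semi_a t)\<^sup>2 = (2 * cos t - 1) / 4"
    using c by (simp add: semi_a_def power_divide)
  have b: "(semi_b t)\<^sup>2 = (2 * cos t - 1) * (1 - cos t) / 2"
    using c by (simp add: semi_b_def power_divide)
  show ?thesis
    unfolding ellipse_fun_def a b using c by (simp add: add_divide_distrib mult_ac)
qed

text \<open>The closed form is available on the open parameter interval, which suffices because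
  differentiation is local.\<close>

lemma ellipse_fun_has_derivative:
  assumes t: "t \<in> {0<..<pi / 3}"
  shows "((\<lambda>s. ellipse_fun x y s) has_real_derivative
    ((4 * (y + sin t) * cos t / (1 - cos t) - 2 * (y + sin t)\<^sup>2 * sin t / (1 - cos t)\<^sup>2)
       * (2 * cos t - 1)
     + 2 * sin t * (4 * x\<^sup>2 + 2 * (y + sin t)\<^sup>2 / (1 - cos t))) / (2 * cos t - 1)\<^sup>2) (at t)"
proof (rule has_field_derivative_transform_within_open[OF _ _ t])
  have c: "2 * cos t - 1 \<noteq> 0" "1 - cos t \<noteq> 0"
    using cos_gt_half[OF t] cos_less_one[OF t] by auto
  show "((\<lambda>t. (4 * x\<^sup>2 + 2 * (y + sin t)\<^sup>2 / (1 - cos t)) / (2 * cos t - 1) - 1)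
    has_real_derivative
    ((4 * (y + sin t) * cos t / (1 - cos t) - 2 * (y + sin t)\<^sup>2 * sin t / (1 - cos t)\<^sup>2)
       * (2 * cos t - 1)
     + 2 * sin t * (4 * x\<^sup>2 + 2 * (y + sin t)\<^sup>2 / (1 - cos t))) / (2 * cos t - 1)\<^sup>2) (at t)"
    using c by (auto intro!: derivative_eq_intros)
      (simp add: divide_simps; simp add: algebra_simps power2_eq_square)
qed (auto simp: ellipse_fun_eq)

section \<open>Solving the envelope conditions at a fixed parameter\<close>

text \<open>Replacing cosine and sine by a point \<open>(c, s)\<close> of the unit circle turns the
  task into polynomial algebra; \<open>N'\<close> is the derivative of \<open>N\<close> in the
  angle.\<close>

lemma envelope_system_iff:
  fixes c s x y :: real
  assumes c: "1 / 2 < c" "c < 1" and s: "0 < s" and sc: "s\<^sup>2 = 1 - c\<^sup>2"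
  defines "N \<equiv> 4 * x\<^sup>2 + 2 * (y + s)\<^sup>2 / (1 - c)"
    and "N' \<equiv> 4 * (y + s) * c / (1 - c) - 2 * (y + s)\<^sup>2 * s / (1 - c)\<^sup>2"
  shows "N = 2 * c - 1 \<and> N' = - 2 * s \<longleftrightarrow>
    4 * x\<^sup>2 = (5 * c - 3) / (c + 1) \<and> y = - (2 * s / (c + 1))"
proof -
  \<comment> \<open>Modulo \<open>s^2 = 1 - c^2\<close> the discriminant of the quadratic in
    \<open>y + s\<close> is a perfect square, so it splits; the root \<open>y + s = s\<close>
    appears as the factor \<open>y\<close>.\<close>
  have factor: "(1 - c)\<^sup>2 * s * (N' + 2 * s) = - 2 * y * s * (s * y + 2 * (1 - c))"
  proof -
    have clear: "e\<^sup>2 * (A / e - B / e\<^sup>2) = A * e - B" if "e \<noteq> 0" for e A B :: real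
      using that by (simp add: right_diff_distrib power2_eq_square)
    have "(1 - c)\<^sup>2 * N' = 4 * (y + s) * c * (1 - c) - 2 * (y + s)\<^sup>2 * s"
      unfolding N'_def using c by (intro clear) simp
    then have "(1 - c)\<^sup>2 * s * (N' + 2 * s) =
        s * (4 * (y + s) * c * (1 - c) - 2 * (y + s)\<^sup>2 * s) + 2 * s\<^sup>2 * (1 - c)\<^sup>2"
      by algebra
    also have "\<dots> = - 2 * y * s * (s * y + 2 * (1 - c))"
      using sc by algebra
    finally show ?thesis .
  qed
  have root: "s * y + 2 * (1 - c) = 0 \<longleftrightarrow> y = - (2 * s / (c + 1))"
  proof -
    \<comment> \<open>The half-angle identity \<open>(1 - c) / s = s / (1 + c)\<close>, with
      denominators cleared.\<close>
    have "s * y + 2 * (1 - c) = 0 \<longleftrightarrow> s * ((c + 1) * y + 2 * s) = 0"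
    proof -
      have "s * ((c + 1) * y + 2 * s) = (c + 1) * (s * y + 2 * (1 - c))"
        using sc by algebra
      then show ?thesis using c by simp
    qed
    also have "\<dots> \<longleftrightarrow> (c + 1) * y + 2 * s = 0"
      using s by simp
    also have "\<dots> \<longleftrightarrow> y = - (2 * s / (c + 1))"
      using c by (simp add: field_simps) argo
    finally show ?thesis .
  qed
  have "N' = - 2 * s \<longleftrightarrow> (1 - c)\<^sup>2 * s * (N' + 2 * s) = 0"
    using c s by (simp, argo)
  also have "\<dots> \<longleftrightarrow> y = 0 \<or> y = - (2 * s / (c + 1))"
    unfolding factor root[symmetric] using s by auto
  finally have N': "N' = - 2 * s \<longleftrightarrow> y = 0 \<or> y = - (2 * s / (c + 1))" .
  have zero: "N \<noteq> 2 * c - 1" if "y = 0"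
  proof
    assume "N = 2 * c - 1"
    moreover have "N = 4 * x\<^sup>2 + 2 * (1 + c)"
    proof -
      have "s\<^sup>2 = (1 + c) * (1 - c)" using sc by algebra
      then show ?thesis using c that by (simp add: N_def)
    qed
    ultimately have "4 * x\<^sup>2 = -3" by simp
    then show False using zero_le_power2[of x] by linarith
  qed
  have second: "N = 2 * c - 1 \<longleftrightarrow> 4 * x\<^sup>2 = (5 * c - 3) / (c + 1)"
    if y: "y = - (2 * s / (c + 1))"
  proof -
    have "(c + 1) * (y + s) = - s * (1 - c)"
      using c y by (simp add: field_simps)
    then have "((c + 1) * (y + s))\<^sup>2 = (c + 1) * (1 - c) ^ 3"
      using sc by algebra
    then have "(c + 1) * ((c + 1) * (y + s)\<^sup>2) = (c + 1) * (1 - c) ^ 3"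
      by algebra
    then have "(c + 1) * (y + s)\<^sup>2 = (1 - c) ^ 3" using c by simp
    then have "(y + s)\<^sup>2 / (1 - c) = (1 - c)\<^sup>2 / (c + 1)"
      using c by (simp add: field_simps power2_eq_square power3_eq_cube)
    then have "N = 4 * x\<^sup>2 + 2 * ((1 - c)\<^sup>2 / (c + 1))"
      by (simp add: N_def flip: times_divide_eq_right)
    moreover have "2 * c - 1 = 2 * ((1 - c)\<^sup>2 / (c + 1)) + (5 * c - 3) / (c + 1)"
      using c by (simp add: divide_simps) (simp add: algebra_simps power2_eq_square)
    ultimately show ?thesis by linarith
  qed
  show ?thesis using N' zero second by blast
qed

lemma envelope_condition_iff:
  assumes t: "t \<in> {0<..<pi / 3}"
  shows "ellipse_fun x y t = 0 \<and> ((\<lambda>s. ellipse_fun x y s) has_real_derivative 0) (at t) \<longleftrightarrow>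
    4 * x\<^sup>2 = (5 * cos t - 3) / (cos t + 1) \<and> y = - (2 * sin t / (cos t + 1))"
proof -
  define N where "N = 4 * x\<^sup>2 + 2 * (y + sin t)\<^sup>2 / (1 - cos t)"
  define N' where
    "N' = 4 * (y + sin t) * cos t / (1 - cos t) - 2 * (y + sin t)\<^sup>2 * sin t / (1 - cos t)\<^sup>2"
  have c: "2 * cos t - 1 \<noteq> 0" using cos_gt_half[OF t] by simp
  have F: "ellipse_fun x y t = 0 \<longleftrightarrow> N = 2 * cos t - 1"
    using c by (auto simp: ellipse_fun_eq[OF t] N_def[symmetric])
  have "((\<lambda>s. ellipse_fun x y s) has_real_derivative 0) (at t) \<longleftrightarrow>
      (N' * (2 * cos t - 1) + 2 * sin t * N) / (2 * cos t - 1)\<^sup>2 = 0"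
    using ellipse_fun_has_derivative[OF t, of x y, folded N_def N'_def]
    by (metis DERIV_unique)
  also have "\<dots> \<longleftrightarrow> N' * (2 * cos t - 1) + 2 * sin t * N = 0"
    using c by simp
  finally have D: "((\<lambda>s. ellipse_fun x y s) has_real_derivative 0) (at t) \<longleftrightarrow>
      N' * (2 * cos t - 1) + 2 * sin t * N = 0" .
  \<comment> \<open>Substituting \<open>N = 2 * cos t - 1\<close> into the numerator of the
    derivative lets the factor \<open>2 * cos t - 1\<close> be pulled out.\<close>
  have "ellipse_fun x y t = 0 \<and> ((\<lambda>s. ellipse_fun x y s) has_real_derivative 0) (at t) \<longleftrightarrow>
      N = 2 * cos t - 1 \<and> (N' + 2 * sin t) * (2 * cos t - 1) = 0"
    unfolding F D by (auto simp: distrib_right)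
  also have "\<dots> \<longleftrightarrow> N = 2 * cos t - 1 \<and> N' = - 2 * sin t"
    using c by (auto simp: add_eq_0_iff2)
  also have "\<dots> \<longleftrightarrow> 4 * x\<^sup>2 = (5 * cos t - 3) / (cos t + 1) \<and> y = - (2 * sin t / (cos t + 1))"
    unfolding N_def N'_def
    using envelope_system_iff[of "cos t" "sin t" x y, OF cos_gt_half[OF t] cos_less_one[OF t]
        sin_pos[OF t] sin_squared_eq] .
  finally show ?thesis .
qed

section \<open>The envelope as a set of points\<close>

text \<open>The bound \<open>3 / 5\<close> comes from \<open>x^2\<close> being nonnegative; the two
  signs of the square root give the two branches.\<close>

lemma xi_iff:
  assumes c: "0 < cos t"
  shows "4 * x\<^sup>2 = (5 * cos t - 3) / (cos t + 1) \<and> y = - (2 * sin t / (cos t + 1)) \<longleftrightarrow>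
    3 / 5 \<le> cos t \<and> (x, y) \<in> {xi1 t, xi2 t}"
proof -
  define w where "w = sqrt (5 * cos t - 3) / (2 * sqrt (cos t + 1))"
  have nonneg: "3 / 5 \<le> cos t" if "4 * x\<^sup>2 = (5 * cos t - 3) / (cos t + 1)"
  proof -
    have "0 \<le> (5 * cos t - 3) / (cos t + 1)"
      unfolding that[symmetric] by simp
    then show ?thesis using c by (simp add: zero_le_divide_iff)
  qed
  have "4 * x\<^sup>2 = (5 * cos t - 3) / (cos t + 1) \<longleftrightarrow> x = w \<or> x = - w" if "3 / 5 \<le> cos t"
  proof -
    have "4 * w\<^sup>2 = (5 * cos t - 3) / (cos t + 1)"
      using that c by (simp add: w_def power_divide power_mult_distrib)
        (simp add: divide_simps; simp add: algebra_simps)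
    then have "4 * x\<^sup>2 = (5 * cos t - 3) / (cos t + 1) \<longleftrightarrow> x\<^sup>2 = w\<^sup>2" by linarith
    then show ?thesis by (simp add: power2_eq_iff)
  qed
  then show ?thesis
    using nonneg unfolding xi1_def xi2_def w_def[symmetric] by auto
qed

lemma envelope_eq:
  "envelope {0<..<pi / 3} ellipse_fun =
     (\<Union>t\<in>{t. 0 < t \<and> t < pi / 3 \<and> cos t \<ge> 3 / 5}. {xi1 t, xi2 t})"
proof -
  have "z \<in> envelope {0<..<pi / 3} ellipse_fun \<longleftrightarrow>
      (\<exists>t\<in>{0<..<pi / 3}. 3 / 5 \<le> cos t \<and> z \<in> {xi1 t, xi2 t})" for z
  proof (cases z)
    case (Pair x y)
    have "z \<in> envelope {0<..<pi / 3} ellipse_fun \<longleftrightarrow>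
        (\<exists>t\<in>{0<..<pi / 3}. 4 * x\<^sup>2 = (5 * cos t - 3) / (cos t + 1)
          \<and> y = - (2 * sin t / (cos t + 1)))"
      by (simp add: envelope_def Pair envelope_condition_iff del: greaterThanLessThan_iff
          cong: bex_cong)
    also have "\<dots> \<longleftrightarrow> (\<exists>t\<in>{0<..<pi / 3}. 3 / 5 \<le> cos t \<and> z \<in> {xi1 t, xi2 t})"
      unfolding Pair using cos_gt_half by (intro bex_cong refl xi_iff) force
    finally show ?thesis .
  qed
  then show ?thesis by (intro set_eqI) (simp only:, auto)
qed

lemma envelope_subset:
  "envelope {0<..<pi / 3} ellipse_fun \<subseteq> {(x, y). 4 * x\<^sup>2 + y\<^sup>2 - 1 = 0}"
proof
  fix z assume "z \<in> envelope {0<..<pi / 3} ellipse_fun"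
  then obtain t x y where t: "t \<in> {0<..<pi / 3}" and z: "z = (x, y)"
    and "ellipse_fun x y t = 0 \<and> ((\<lambda>s. ellipse_fun x y s) has_real_derivative 0) (at t)"
    unfolding envelope_def by blast
  then have x: "4 * x\<^sup>2 = (5 * cos t - 3) / (cos t + 1)"
    and y: "y = - (2 * sin t / (cos t + 1))"
    using envelope_condition_iff[OF t] by blast+
  have c: "cos t + 1 > 0" using cos_gt_half[OF t] by simp
  have "(sin t)\<^sup>2 = (1 - cos t) * (cos t + 1)"
    by (simp add: sin_squared_eq power2_eq_square algebra_simps)
  then have "y\<^sup>2 = 4 * (1 - cos t) / (cos t + 1)"
    using c by (simp add: y power_divide power_mult_distrib) (simp add: power2_eq_square)
  \<comment> \<open>The two numerators add up to \<open>cos t + 1\<close>, so the quotient is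
    1.\<close>
  then have "4 * x\<^sup>2 + y\<^sup>2 = ((5 * cos t - 3) + 4 * (1 - cos t)) / (cos t + 1)"
    unfolding x by (simp only: add_divide_distrib)
  then show "z \<in> {(x, y). 4 * x\<^sup>2 + y\<^sup>2 - 1 = 0}" using c z by simp
qed

section \<open>Foci of the ellipse\<close>

text \<open>For \<open>r = a + b\<close> one has \<open>r^2 + a^2 - b^2 = 2 * r * a\<close>.
  Squaring this leaves only squared distances, which are polynomial in coordinates.\<close>

lemma two_focus_squared:
  fixes z p q :: "'a :: metric_space"
  assumes "dist z p + dist z q = r"
  shows "4 * r\<^sup>2 * (dist z p)\<^sup>2 = (r\<^sup>2 + (dist z p)\<^sup>2 - (dist z q)\<^sup>2)\<^sup>2"
  unfolding assms[symmetric] by algebra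

lemma dist_prod_squared:
  fixes x y a b :: real
  shows "(dist (x, y) (a, b))\<^sup>2 = (x - a)\<^sup>2 + (y - b)\<^sup>2"
  by (simp add: dist_prod_def dist_real_def)

text \<open>On the ellipse the focal distances are affine in \<open>y\<close>, namely
  \<open>1 + h * y\<close> and \<open>1 - h * y\<close> with \<open>h\<close> the eccentricity, so
  their sum is constant.\<close>

lemma two_focus_ellipse:
  "{(x, y). 4 * x\<^sup>2 + y\<^sup>2 - 1 = 0} = {z. dist z X15 + dist z X16 = 2}"
proof -
  have "4 * x\<^sup>2 + y\<^sup>2 - 1 = 0 \<longleftrightarrow> dist (x, y) X15 + dist (x, y) X16 = 2" for x y :: real
  proof
    define h where "h = sqrt 3 / 2"
    have h: "h\<^sup>2 = 3 / 4" by (simp add: h_def power_divide)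
    have X: "X15 = (0, - h)" "X16 = (0, h)" by (simp_all add: X15_def X16_def h_def)
    {
      assume S: "4 * x\<^sup>2 + y\<^sup>2 - 1 = 0"
      \<comment> \<open>The bound on \<open>h * y\<close> makes both affine expressions nonnegative,
        so the distances can be recovered from their squares.\<close>
      have "y\<^sup>2 \<le> 1" using S zero_le_power2[of x] by linarith
      moreover have "(h * y)\<^sup>2 = 3 / 4 * y\<^sup>2" by (simp add: power_mult_distrib h)
      ultimately have "(h * y)\<^sup>2 \<le> 1" by linarith
      then have hy: "\<bar>h * y\<bar> \<le> 1" using abs_le_square_iff[of "h * y" 1] by simp
      have "(dist (x, y) X15)\<^sup>2 = (1 + h * y)\<^sup>2" "(dist (x, y) X16)\<^sup>2 = (1 - h * y)\<^sup>2"
        unfolding X dist_prod_squared using S h by algebra+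
      then have "dist (x, y) X15 = 1 + h * y" "dist (x, y) X16 = 1 - h * y"
        using hy by (auto intro!: power2_eq_imp_eq)
      then show "dist (x, y) X15 + dist (x, y) X16 = 2" by simp
    }
    assume "dist (x, y) X15 + dist (x, y) X16 = 2"
    from two_focus_squared[OF this] show "4 * x\<^sup>2 + y\<^sup>2 - 1 = 0"
      unfolding X dist_prod_squared using h by algebra
  qed
  then show ?thesis by auto
qed

text \<open>The four vertices settle every coefficient but \<open>\<gamma>\<close>; the rational
  point \<open>(3/10, 4/5)\<close>, from the 3-4-5 triangle, lies off the axes and forces the mixed
  term to vanish.\<close>

lemma quadratic_vanishing_on_ellipse:
  fixes \<alpha> \<beta> \<gamma> \<delta> \<eta> \<kappa> :: real
  assumes "\<forall>x y. 4 * x\<^sup>2 + y\<^sup>2 - 1 = 0 \<longrightarrow>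
    \<alpha> * x\<^sup>2 + \<beta> * y\<^sup>2 + \<gamma> * x * y + \<delta> * x + \<eta> * y + \<kappa> = 0"
  shows "\<gamma> = 0" "\<delta> = 0" "\<eta> = 0" "\<alpha> = - 4 * \<kappa>" "\<beta> = - \<kappa>"
  using assms[rule_format, of 0 1] assms[rule_format, of 0 "-1"] assms[rule_format, of "1/2" 0]
    assms[rule_format, of "-1/2" 0] assms[rule_format, of "3/10" "4/5"]
  by (simp_all add: power2_eq_square)

lemma foci_ellipse_subset:
  "foci {(x, y). 4 * x\<^sup>2 + y\<^sup>2 - 1 = 0} \<subseteq> {X15, X16}"
proof
  fix p assume "p \<in> foci {(x, y). 4 * x\<^sup>2 + y\<^sup>2 - 1 = 0}"
  then obtain q r where pq: "dist p q < r"
    and S: "{(x, y). 4 * x\<^sup>2 + y\<^sup>2 - 1 = 0} = {z. dist z p + dist z q = r}"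
    unfolding foci_def by auto
  obtain p1 p2 q1 q2 where p: "p = (p1, p2)" and q: "q = (q1, q2)" by fastforce
  \<comment> \<open>These are the coefficients in
    \<open>(dist z p)^2 - (dist z q)^2 = k - 2 * d * x - 2 * e * y\<close> for
    \<open>z = (x, y)\<close>.\<close>
  define d e k where "d = p1 - q1" and "e = p2 - q2" and "k = p1\<^sup>2 + p2\<^sup>2 - q1\<^sup>2 - q2\<^sup>2"
  have r: "0 < r" using pq zero_le_dist[of p q] by linarith
  have "\<forall>x y. 4 * x\<^sup>2 + y\<^sup>2 - 1 = 0 \<longrightarrow>
      4 * (r\<^sup>2 - d\<^sup>2) * x\<^sup>2 + 4 * (r\<^sup>2 - e\<^sup>2) * y\<^sup>2 + (- 8 * d * e) * x * y
      + (4 * d * (r\<^sup>2 + k) - 8 * r\<^sup>2 * p1) * x + (4 * e * (r\<^sup>2 + k) - 8 * r\<^sup>2 * p2) * y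
      + (4 * r\<^sup>2 * (p1\<^sup>2 + p2\<^sup>2) - (r\<^sup>2 + k)\<^sup>2) = 0"
  proof (intro allI impI)
    fix x y :: real assume "4 * x\<^sup>2 + y\<^sup>2 - 1 = 0"
    then have "dist (x, y) p + dist (x, y) q = r" using S by blast
    from two_focus_squared[OF this]
    show "4 * (r\<^sup>2 - d\<^sup>2) * x\<^sup>2 + 4 * (r\<^sup>2 - e\<^sup>2) * y\<^sup>2 + (- 8 * d * e) * x * y
      + (4 * d * (r\<^sup>2 + k) - 8 * r\<^sup>2 * p1) * x + (4 * e * (r\<^sup>2 + k) - 8 * r\<^sup>2 * p2) * y
      + (4 * r\<^sup>2 * (p1\<^sup>2 + p2\<^sup>2) - (r\<^sup>2 + k)\<^sup>2) = 0"
      unfolding p q dist_prod_squared d_def e_def k_def by algebra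
  qed
  note coeffs = quadratic_vanishing_on_ellipse[OF this]
  have axes: "r\<^sup>2 - d\<^sup>2 = 4 * (r\<^sup>2 - e\<^sup>2)" using coeffs(4,5) by algebra
  have r2: "r\<^sup>2 > 0" using r by simp
  \<comment> \<open>The mixed term gives \<open>d * e = 0\<close>, and the ratio 4 of the square
    coefficients excludes foci separated along the minor axis.\<close>
  have d0: "d = 0"
  proof (rule ccontr)
    assume "d \<noteq> 0"
    then have "e = 0" using coeffs(1) by simp
    then have "d\<^sup>2 = - 3 * r\<^sup>2" using axes by simp
    then show False using r2 zero_le_power2[of d] by linarith
  qed
  have p1: "p1 = 0" using coeffs(2) d0 r by simp
  have e2: "4 * e\<^sup>2 = 3 * r\<^sup>2" using axes d0 by simp
  have q1: "q1 = 0" using d0 p1 by (simp add: d_def)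
  have k: "k = e * (p2 + q2)"
    by (simp add: k_def e_def p1 q1 power2_eq_square algebra_simps)
  \<comment> \<open>The linear term in \<open>y\<close> places the midpoint of the foci at the
    origin.\<close>
  have "r\<^sup>2 * (p2 + q2) = 0"
    using coeffs(3) e2 k e_def by algebra
  then have sym: "q2 = - p2" using r by simp
  have e: "e = 2 * p2" and k0: "k = 0" using sym k by (simp_all add: e_def)
  \<comment> \<open>Comparing the \<open>y^2\<close> coefficient with the constant term fixes the
    scale, since \<open>3 * r^2 = 16 * p2^2\<close> by \<open>e2\<close> and
    \<open>e\<close>.\<close>
  have "r\<^sup>2 * (4 * p2\<^sup>2 - 3) = 0"
    using coeffs(5) e2 e k0 p1 by algebra
  then have "p2\<^sup>2 = (sqrt 3 / 2)\<^sup>2" using r by (simp add: power_divide)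
  then have "p2 = sqrt 3 / 2 \<or> p2 = - (sqrt 3 / 2)" by (simp only: power2_eq_iff)
  then show "p \<in> {X15, X16}" by (auto simp: p p1 X15_def X16_def)
qed

lemma foci_ellipse: "foci {(x, y). 4 * x\<^sup>2 + y\<^sup>2 - 1 = 0} = {X15, X16}"
proof
  have "sqrt 3 < sqrt 4" by (rule real_sqrt_less_mono) simp
  then have d: "dist X15 X16 < 2" "dist X16 X15 < 2"
    by (simp_all add: X15_def X16_def dist_Pair_Pair dist_real_def)
  \<comment> \<open>Membership in \<open>foci\<close> singles out the first focus, so the
    description is also needed with the two points exchanged.\<close>
  have "{(x, y). 4 * x\<^sup>2 + y\<^sup>2 - 1 = 0} = {z. dist z X16 + dist z X15 = 2}"
    using two_focus_ellipse by (simp add: add.commute)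
  then show "{X15, X16} \<subseteq> foci {(x, y). 4 * x\<^sup>2 + y\<^sup>2 - 1 = 0}"
    using d two_focus_ellipse unfolding foci_def by blast
qed (rule foci_ellipse_subset)

theorem proposition8:
  "envelope {0<..<pi / 3} ellipse_fun =
     (\<Union>t\<in>{t. 0 < t \<and> t < pi / 3 \<and> cos t \<ge> 3 / 5}. {xi1 t, xi2 t}) \<and>
   envelope {0<..<pi / 3} ellipse_fun \<subseteq> {(x, y). 4 * x\<^sup>2 + y\<^sup>2 - 1 = 0} \<and>
   foci {(x, y). 4 * x\<^sup>2 + y\<^sup>2 - 1 = 0} = {X15, X16}"
  using envelope_eq envelope_subset foci_ellipse by blast

end
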